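(* For any positive integer $n$, there exist a finite set $A$ and a lattice $\mathcal{M}$ of equivalence relations on $A$ such that $\mathcal{M} \cong \mathbf{M}_n$ (as lattices) and $\mathrm{Eq}(\mathrm{RA}(\mathcal{M})) = \mathrm{Eq}(\mathrm{FO3}(\mathcal{M})) = \mathcal{M}$.
   Context: $\mathbf{M}_n$ denotes the lattice consisting of a least element, a greatest element, and exactly $n$ further pairwise incomparable elements lying strictly between them (so $\mathbf{M}_n$ has $n+2$ elements). A lattice of equivalence relations on a set $A$ is a sublattice of the lattice of all equivalence relations on $A$ (ordered by inclusion, with meet being intersection and join being the smallest equivalence relation containing the union). For a set $\mathcal{R}$ of relations on $A$, $\mathrm{Eq}(\mathcal{R})$ is the set of all equivalence relations on $A$ that belong to $\mathcal{R}$. For a set $\mathcal{R}$ of relations on a finite set $A$, $\mathrm{FO3}(\mathcal{R})$ is the set of all relations on $A$ definable by first-order formulas (with equality, without parameters) using at most three variables and with relation symbols interpreted by relations from $\mathcal{R}$. For a set $\mathcal{R}$ of binary relations on $A$, $\mathrm{RA}(\mathcal{R})$ is the relation algebra generated by $\mathcal{R}$, i.e. the smallest set of binary relations on $A$ that contains $\mathcal{R}$ and the identity relation on $A$ and is closed under union, complement (relative to $A \times A$), relational composition, and converse. *)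

theory Defs
  imports "HOL-Algebra.Lattice"
begin

section \<open>Lattices of equivalence relations\<close>

definition lattice_isomorphic :: "'a gorder \<Rightarrow> 'b gorder \<Rightarrow> bool" where
  "lattice_isomorphic K L \<longleftrightarrow> lattice K \<and> lattice L \<and>
     (\<exists>f. bij_betw f (carrier K) (carrier L) \<and>
          (\<forall>x \<in> carrier K. \<forall>y \<in> carrier K.
             f (x \<sqinter>\<^bsub>K\<^esub> y) = f x \<sqinter>\<^bsub>L\<^esub> f y \<and>
             f (x \<squnion>\<^bsub>K\<^esub> y) = f x \<squnion>\<^bsub>L\<^esub> f y))"

text \<open>The lattice with least element 0, greatest element \<open>n + 1\<close>, and the \<open>n\<close> pairwise
  incomparable elements \<open>1, \<dots>, n\<close> strictly between them.\<close>

definition M_lattice :: "nat \<Rightarrow> nat gorder" where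
  "M_lattice n = \<lparr> carrier = {0..n + 1}, eq = (=),
                  le = (\<lambda>x y. x = y \<or> x = 0 \<or> y = n + 1) \<rparr>"

definition inclusion_order :: "'a set set \<Rightarrow> 'a set gorder" where
  "inclusion_order S = \<lparr> carrier = S, eq = (=), le = (\<subseteq>) \<rparr>"

definition equiv_join :: "'a set \<Rightarrow> 'a rel \<Rightarrow> 'a rel \<Rightarrow> 'a rel" where
  "equiv_join A E F = \<Inter> {G. equiv A G \<and> E \<union> F \<subseteq> G}"

text \<open>A sublattice of the lattice of all equivalence relations on \<open>A\<close>. Because of the two closure
  conditions, the meets and joins of \<open>inclusion_order M\<close> are then \<open>\<inter>\<close> and \<open>equiv_join A\<close>.
  The sublattice need not contain the least or the greatest equivalence relation on \<open>A\<close>.\<close>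

definition equiv_lattice :: "'a set \<Rightarrow> 'a rel set \<Rightarrow> bool" where
  "equiv_lattice A M \<longleftrightarrow> M \<noteq> {} \<and> (\<forall>E \<in> M. equiv A E) \<and>
     (\<forall>E \<in> M. \<forall>F \<in> M. E \<inter> F \<in> M \<and> equiv_join A E F \<in> M)"


section \<open>Relations of arbitrary arity\<close>

text \<open>A \<open>k\<close>-ary relation on \<open>A\<close> is a set of lists of length \<open>k\<close> over \<open>A\<close>; \<open>as_relation\<close> is the
  (injective) translation of binary relations, given as sets of pairs, into this format.\<close>

definition as_relation :: "'a rel \<Rightarrow> 'a list set" where
  "as_relation E = {[x, y] | x y. (x, y) \<in> E}"

definition Eq :: "'a set \<Rightarrow> 'a list set set \<Rightarrow> 'a rel set" where
  "Eq A R = {E. equiv A E \<and> as_relation E \<in> R}"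


section \<open>Definability by three-variable formulas\<close>

datatype var = V1 | V2 | V3

text \<open>The relation symbols are the relations themselves, each interpreted as itself. An atom whose
  number of arguments differs from the arity of its relation symbol is false, so such atoms add
  no definable relations. The remaining connectives and the universal quantifier are definable
  from the ones below without additional variables.\<close>

datatype 'a fo3 =
    Equal var var
  | Atom "'a list set" "var list"
  | Neg "'a fo3"
  | Conj "'a fo3" "'a fo3"
  | Exists var "'a fo3"

primrec symbols :: "'a fo3 \<Rightarrow> 'a list set set" where
  "symbols (Equal x y) = {}"
| "symbols (Atom r xs) = {r}"
| "symbols (Neg \<phi>) = symbols \<phi>"
| "symbols (Conj \<phi> \<psi>) = symbols \<phi> \<union> symbols \<psi>"
| "symbols (Exists x \<phi>) = symbols \<phi>"

primrec free_vars :: "'a fo3 \<Rightarrow> var set" where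
  "free_vars (Equal x y) = {x, y}"
| "free_vars (Atom r xs) = set xs"
| "free_vars (Neg \<phi>) = free_vars \<phi>"
| "free_vars (Conj \<phi> \<psi>) = free_vars \<phi> \<union> free_vars \<psi>"
| "free_vars (Exists x \<phi>) = free_vars \<phi> - {x}"

primrec sat :: "'a set \<Rightarrow> (var \<Rightarrow> 'a) \<Rightarrow> 'a fo3 \<Rightarrow> bool" where
  "sat A v (Equal x y) \<longleftrightarrow> v x = v y"
| "sat A v (Atom r xs) \<longleftrightarrow> map v xs \<in> r"
| "sat A v (Neg \<phi>) \<longleftrightarrow> \<not> sat A v \<phi>"
| "sat A v (Conj \<phi> \<psi>) \<longleftrightarrow> sat A v \<phi> \<and> sat A v \<psi>"
| "sat A v (Exists x \<phi>) \<longleftrightarrow> (\<exists>a \<in> A. sat A (v(x := a)) \<phi>)"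

text \<open>The relation defined by \<open>\<phi>\<close> with respect to a list \<open>xs\<close> of distinct variables that
  includes all the free variables of \<open>\<phi>\<close>; its arity is the length of \<open>xs\<close>.\<close>

definition FO3 :: "'a set \<Rightarrow> 'a list set set \<Rightarrow> 'a list set set" where
  "FO3 A R = {{map v xs | v. range v \<subseteq> A \<and> sat A v \<phi>} | \<phi> xs.
     symbols \<phi> \<subseteq> R \<and> distinct xs \<and> free_vars \<phi> \<subseteq> set xs}"


section \<open>Generated relation algebras\<close>

inductive_set RA :: "'a set \<Rightarrow> 'a rel set \<Rightarrow> 'a rel set"
  for A :: "'a set" and R :: "'a rel set" where
  base: "r \<in> R \<Longrightarrow> r \<in> RA A R"
| ident: "Id_on A \<in> RA A R"
| union: "r \<in> RA A R \<Longrightarrow> s \<in> RA A R \<Longrightarrow> r \<union> s \<in> RA A R"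
| compl: "r \<in> RA A R \<Longrightarrow> A \<times> A - r \<in> RA A R"
| comp: "r \<in> RA A R \<Longrightarrow> s \<in> RA A R \<Longrightarrow> r O s \<in> RA A R"
| conv: "r \<in> RA A R \<Longrightarrow> r\<inverse> \<in> RA A R"

end

theory Submission
  imports Defs "HOL-Number_Theory.Cong" "HOL-Computational_Algebra.Primes"
begin

text \<open>Take the affine plane over a prime field with \<open>p \<ge> n + 2\<close>, so that at least three of its
  \<open>p + 1\<close> directions are left over after \<open>n\<close> of them have been chosen. The lattice consists of the
  identity, the full relation and the parallelism relations of the \<open>n\<close> chosen directions. Colour a
  pair of distinct points by its direction, giving all the remaining directions one common colour.
  Any two pairs of the same colour extend to triangles with the same colours, so by a back-and-forth
  argument relations definable with three variables are unions of colours. An invariant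
  equivalence relation that contains lines in two directions is full, which leaves only the members
  of the lattice.\<close>

section \<open>Order isomorphisms of lattices\<close>

text \<open>Being onto and order-reflecting, \<open>f\<close> maps the upper and lower bounds of a
  pair exactly onto those of the image pair, so suprema and infima carry over. \<open>L\<close>
  inherits being a lattice, and meets and joins in \<open>M_lattice\<close> never have to be
  computed.\<close>

lemma order_iso_imp_lattice_isomorphic:
  fixes K :: "'a gorder" and L :: "'b gorder"
  assumes K: "lattice K"
    and eq_L: "(.=\<^bsub>L\<^esub>) = (=)"
    and bij: "bij_betw f (carrier K) (carrier L)"
    and le: "\<And>x y. x \<in> carrier K \<Longrightarrow> y \<in> carrier K \<Longrightarrow> f x \<sqsubseteq>\<^bsub>L\<^esub> f y \<longleftrightarrow> x \<sqsubseteq>\<^bsub>K\<^esub> y"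
  shows "lattice_isomorphic K L"
proof -
  interpret K: lattice K by (rule K)
  have carrier_L: "carrier L = f ` carrier K"
    using bij by (simp add: bij_betw_def)
  have inj: "f x = f y \<longleftrightarrow> x = y" if "x \<in> carrier K" "y \<in> carrier K" for x y
    using bij that by (auto simp: bij_betw_def inj_on_def)
  interpret L: partial_order L
  proof
    fix x y z
    assume "x \<in> carrier L" "y \<in> carrier L" "z \<in> carrier L" "x \<sqsubseteq>\<^bsub>L\<^esub> y" "y \<sqsubseteq>\<^bsub>L\<^esub> z"
    then show "x \<sqsubseteq>\<^bsub>L\<^esub> z"
      unfolding carrier_L by (auto simp: le intro: K.le_trans)
  qed (auto simp: eq_L carrier_L le inj intro: K.le_antisym)
  have least_join: "least L (f (x \<squnion>\<^bsub>K\<^esub> y)) (Upper L {f x, f y})"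
    if "x \<in> carrier K" "y \<in> carrier K" for x y
  proof -
    have "least K (x \<squnion>\<^bsub>K\<^esub> y) (Upper K {x, y})"
      using that by (simp add: join_def K.sup_of_two_least)
    moreover have "Upper L {f x, f y} = f ` Upper K {x, y}"
      using that by (auto simp: Upper_def carrier_L le)
    ultimately show ?thesis
      by (auto simp: least_def carrier_L le subset_iff)
  qed
  have greatest_meet: "greatest L (f (x \<sqinter>\<^bsub>K\<^esub> y)) (Lower L {f x, f y})"
    if "x \<in> carrier K" "y \<in> carrier K" for x y
  proof -
    have "greatest K (x \<sqinter>\<^bsub>K\<^esub> y) (Lower K {x, y})"
      using that by (simp add: meet_def K.inf_of_two_greatest)
    moreover have "Lower L {f x, f y} = f ` Lower K {x, y}"
      using that by (auto simp: Lower_def carrier_L le)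
    ultimately show ?thesis
      by (auto simp: greatest_def carrier_L le subset_iff)
  qed
  interpret L: lattice L
    by unfold_locales (auto simp: carrier_L intro: least_join greatest_meet)
  have "f (x \<squnion>\<^bsub>K\<^esub> y) = f x \<squnion>\<^bsub>L\<^esub> f y" "f (x \<sqinter>\<^bsub>K\<^esub> y) = f x \<sqinter>\<^bsub>L\<^esub> f y"
    if "x \<in> carrier K" "y \<in> carrier K" for x y
  proof -
    have "f x \<in> carrier L" "f y \<in> carrier L"
      using that by (auto simp: carrier_L)
    then show "f (x \<squnion>\<^bsub>K\<^esub> y) = f x \<squnion>\<^bsub>L\<^esub> f y" "f (x \<sqinter>\<^bsub>K\<^esub> y) = f x \<sqinter>\<^bsub>L\<^esub> f y"
      using least_join[OF that] greatest_meet[OF that]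
      by (metis L.least_unique L.sup_of_two_least join_def,
          metis L.greatest_unique L.inf_of_two_greatest meet_def)
  qed
  then show ?thesis
    unfolding lattice_isomorphic_def using K L.lattice_axioms bij by blast
qed

section \<open>Equivalence relations ordered by inclusion\<close>

lemma equiv_join_subset:
  "equiv A G \<Longrightarrow> E \<subseteq> G \<Longrightarrow> F \<subseteq> G \<Longrightarrow> equiv_join A E F \<subseteq> G"
  by (auto simp: equiv_join_def)

lemma equiv_join_upper: "E \<subseteq> equiv_join A E F" "F \<subseteq> equiv_join A E F"
  by (auto simp: equiv_join_def)

lemma lattice_inclusion_order:
  assumes "equiv_lattice A M"
  shows "lattice (inclusion_order M)"
proof -
  interpret partial_order "inclusion_order M"
    by unfold_locales (auto simp: inclusion_order_def)
  show ?thesis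
  proof
    fix E F
    assume "E \<in> carrier (inclusion_order M)" "F \<in> carrier (inclusion_order M)"
    then have M: "E \<in> M" "F \<in> M"
      by (auto simp: inclusion_order_def)
    have "equiv_join A E F \<subseteq> G" if "G \<in> M" "E \<subseteq> G" "F \<subseteq> G" for G
      using assms that by (intro equiv_join_subset) (auto simp: equiv_lattice_def)
    moreover have "equiv_join A E F \<in> M"
      using assms M by (auto simp: equiv_lattice_def)
    ultimately have "least (inclusion_order M) (equiv_join A E F) (Upper (inclusion_order M) {E, F})"
      using M equiv_join_upper[of E A F] equiv_join_upper[of F A E]
      by (simp add: least_def Upper_def inclusion_order_def equiv_join_upper)
    then show "\<exists>s. least (inclusion_order M) s (Upper (inclusion_order M) {E, F})" ..
    have "greatest (inclusion_order M) (E \<inter> F) (Lower (inclusion_order M) {E, F})"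
      using assms M by (auto simp: greatest_def Lower_def inclusion_order_def equiv_lattice_def)
    then show "\<exists>s. greatest (inclusion_order M) s (Lower (inclusion_order M) {E, F})" ..
  qed
qed


section \<open>Colourings that three variables cannot refine\<close>

lemma pair_in_as_relation [simp]: "[x, y] \<in> as_relation E \<longleftrightarrow> (x, y) \<in> E"
  by (auto simp: as_relation_def)

lemma inj_as_relation: "inj as_relation"
proof (rule injI)
  fix E F :: "'a rel"
  assume "as_relation E = as_relation F"
  then have "(x, y) \<in> E \<longleftrightarrow> (x, y) \<in> F" for x y
    by (metis pair_in_as_relation)
  then show "E = F" by auto
qed

lemma Eq_as_relation_image: "Eq A (as_relation ` R) = {E \<in> R. equiv A E}"
  by (auto simp: Eq_def inj_image_mem_iff[OF inj_as_relation])

lemma as_relation_in_FO3: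
  assumes "E \<in> M" "E \<subseteq> A \<times> A"
  shows "as_relation E \<in> FO3 A (as_relation ` M)"
proof -
  let ?\<phi> = "Atom (as_relation E) [V1, V2]"
  have "as_relation E = {map v [V1, V2] | v. range v \<subseteq> A \<and> sat A v ?\<phi>}" (is "_ = ?S")
  proof
    show "as_relation E \<subseteq> ?S"
    proof
      fix l assume "l \<in> as_relation E"
      then obtain x y where l: "l = [x, y]" and xy: "(x, y) \<in> E"
        by (auto simp: as_relation_def)
      \<comment> \<open>\<open>V3\<close> does not occur in the formula; giving it the value
        \<open>y\<close> as well keeps the range inside \<open>A\<close>.\<close>
      define v where "v = (\<lambda>k. if k = V1 then x else y)"
      have "range v \<subseteq> A" "l = map v [V1, V2]" "sat A v ?\<phi>"
        using xy assms(2) by (auto simp: v_def l)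
      then show "l \<in> ?S" by blast
    qed
  qed auto
  moreover have "symbols ?\<phi> \<subseteq> as_relation ` M" "distinct [V1, V2]" "free_vars ?\<phi> \<subseteq> set [V1, V2]"
    using assms(1) by auto
  ultimately show ?thesis
    unfolding FO3_def by blast
qed

lemma other_vars:
  fixes i :: var
  obtains j k where "\<And>l. l = i \<or> l = j \<or> l = k" "i \<noteq> j" "i \<noteq> k" "j \<noteq> k"
proof -
  have "l = V1 \<or> l = V2 \<or> l = V3" for l
    by (cases l) auto
  then show ?thesis
    using that[of V2 V3] that[of V1 V3] that[of V1 V2] by (cases i) blast+
qed

text \<open>Colour classes behave like the atoms of a symmetric relation algebra: colour 0 is the
  identity, and \<open>extend\<close> says that composing two classes gives a union of classes. The
  same condition is the answering move in a back-and-forth game with three pebbles.\<close>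

locale extendable_colouring =
  fixes A :: "'a set" and c :: "'a \<Rightarrow> 'a \<Rightarrow> nat"
  assumes eq_iff: "\<And>x y. x \<in> A \<Longrightarrow> y \<in> A \<Longrightarrow> c x y = 0 \<longleftrightarrow> x = y"
    and sym: "\<And>x y. x \<in> A \<Longrightarrow> y \<in> A \<Longrightarrow> c x y = c y x"
    and extend: "\<And>x y z x' y'. x \<in> A \<Longrightarrow> y \<in> A \<Longrightarrow> z \<in> A \<Longrightarrow> x' \<in> A \<Longrightarrow> y' \<in> A \<Longrightarrow>
      c x y = c x' y' \<Longrightarrow> \<exists>z'\<in>A. c x' z' = c x z \<and> c z' y' = c z y"
begin

definition invariant :: "'a rel \<Rightarrow> bool" where
  "invariant E \<longleftrightarrow> E \<subseteq> A \<times> A \<and>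
     (\<forall>x\<in>A. \<forall>y\<in>A. \<forall>x'\<in>A. \<forall>y'\<in>A. c x y = c x' y' \<longrightarrow> (x, y) \<in> E \<longrightarrow> (x', y') \<in> E)"

lemma invariant_subset: "invariant E \<Longrightarrow> E \<subseteq> A \<times> A"
  by (simp add: invariant_def)

lemma invariantD:
  "invariant E \<Longrightarrow> (x, y) \<in> E \<Longrightarrow> x' \<in> A \<Longrightarrow> y' \<in> A \<Longrightarrow> c x y = c x' y' \<Longrightarrow> (x', y') \<in> E"
  unfolding invariant_def by blast

text \<open>The unions of colour classes are themselves closed under the operations:
  \<open>eq_iff\<close> handles the identity, \<open>sym\<close> the converse, and
  \<open>extend\<close> the composition by transporting the midpoint \<open>z\<close> to the new
  pair.\<close>

lemma invariant_RA:
  assumes "\<And>E. E \<in> M \<Longrightarrow> invariant E" and "r \<in> RA A M"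
  shows "invariant r"
  using assms(2)
proof induction
  case (base r)
  then show ?case by (rule assms(1))
next
  case ident
  then show ?case
    unfolding invariant_def by (metis Id_onE Id_onI Id_on_subset_Times eq_iff Pair_inject)
next
  case (union r s)
  then show ?case
    unfolding invariant_def by blast
next
  case (compl r)
  then show ?case
    unfolding invariant_def by (metis Diff_iff Diff_subset SigmaI)
next
  case (comp r s)
  show ?case
    unfolding invariant_def
  proof (intro conjI ballI impI)
    show "r O s \<subseteq> A \<times> A"
      using comp.IH[THEN invariant_subset] by auto
  next
    fix x y x' y'
    assume A: "x \<in> A" "y \<in> A" "x' \<in> A" "y' \<in> A" and c: "c x y = c x' y'" and "(x, y) \<in> r O s"
    then obtain z where z: "(x, z) \<in> r" "(z, y) \<in> s" by auto
    then have "z \<in> A"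
      using comp.IH(1)[THEN invariant_subset] by auto
    then obtain z' where "z' \<in> A" "c x' z' = c x z" "c z' y' = c z y"
      using extend[OF A(1,2) _ A(3,4) c] by blast
    then show "(x', y') \<in> r O s"
      using z A comp.IH[THEN invariantD] by (metis relcomp.relcompI)
  qed
next
  case (conv r)
  then show ?case
    unfolding invariant_def
    by (smt (verit) sym converse_iff mem_Sigma_iff subrelI subset_iff)
qed

text \<open>Back and forth. At a quantifier over \<open>i\<close>, the values of the other two
  variables form pairs of the same colour under \<open>v\<close> and \<open>w\<close>, and
  \<open>extend\<close> answers a witness for one assignment with a witness for the other. With four
  variables a triangle, not just a pair, would have to be extended.\<close>

lemma sat_cong:
  assumes "\<And>E. E \<in> M \<Longrightarrow> invariant E" and "symbols \<phi> \<subseteq> as_relation ` M"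
    and "range v \<subseteq> A" "range w \<subseteq> A" and "\<And>i j. c (v i) (v j) = c (w i) (w j)"
  shows "sat A v \<phi> \<longleftrightarrow> sat A w \<phi>"
  using assms(2-)
proof (induction \<phi> arbitrary: v w)
  case (Equal i j)
  then show ?case
    by (metis eq_iff range_subsetD sat.simps(1))
next
  case (Atom r xs)
  then obtain E where E: "E \<in> M" and r: "r = as_relation E" by auto
  have "map w xs \<in> r" if "map v xs \<in> r"
    and "range w \<subseteq> A" "\<And>i j. c (v i) (v j) = c (w i) (w j)" for v w
  proof -
    from that(1) obtain i j where xs: "xs = [i, j]"
      by (auto simp: r as_relation_def)
    have "w i \<in> A" "w j \<in> A"
      using that(2) by auto
    then show ?thesis
      using that invariantD[OF assms(1)[OF E]] by (auto simp: r xs)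
  qed
  from this[of v w] this[of w v] Atom.prems show ?case by auto
next
  case (Neg \<phi>)
  then show ?case by (metis sat.simps(3) symbols.simps(3))
next
  case (Conj \<phi> \<psi>)
  then show ?case by (metis le_sup_iff sat.simps(4) symbols.simps(4))
next
  case (Exists i \<phi>)
  obtain j k where jk: "\<And>l. l = i \<or> l = j \<or> l = k" "i \<noteq> j" "i \<noteq> k" "j \<noteq> k"
    using other_vars[of i] by metis
  have "sat A w (Exists i \<phi>)" if sat: "sat A v (Exists i \<phi>)"
    and v: "range v \<subseteq> A" and w: "range w \<subseteq> A" and c: "\<And>i j. c (v i) (v j) = c (w i) (w j)" for v w
  proof -
    from sat obtain a where a: "a \<in> A" "sat A (v(i := a)) \<phi>" by auto
    have A: "v l \<in> A" "w l \<in> A" for l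
      using v w by auto
    obtain b where b: "b \<in> A" "c (w j) b = c (v j) a" "c b (w k) = c a (v k)"
      using extend[OF A(1) A(1) a(1) A(2) A(2) c] by blast
    \<comment> \<open>\<open>extend\<close> fixes one orientation of each new pair; symmetry
      supplies the other, and equal points share colour 0.\<close>
    have b': "c b (w j) = c a (v j)" "c (w k) b = c (v k) a" "c b b = c a a"
      using b A a(1) by (metis sym, metis sym, metis eq_iff)
    have "c ((v(i := a)) l) ((v(i := a)) m) = c ((w(i := b)) l) ((w(i := b)) m)" for l m
      using jk(1)[of l] jk(1)[of m] jk(2,3) b b' c by auto
    moreover have "range (v(i := a)) \<subseteq> A" "range (w(i := b)) \<subseteq> A"
      using a(1) b(1) A by auto
    moreover have "symbols \<phi> \<subseteq> as_relation ` M"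
      using Exists.prems(1) by simp
    ultimately have "sat A (w(i := b)) \<phi>"
      using Exists.IH[of "v(i := a)" "w(i := b)"] a(2) by blast
    then show ?thesis
      using b(1) by auto
  qed
  from this[of v w] this[of w v] Exists.prems(2-) show ?case by metis
qed

lemma invariant_FO3:
  assumes M: "\<And>E. E \<in> M \<Longrightarrow> invariant E"
    and E: "as_relation E \<in> FO3 A (as_relation ` M)" "E \<subseteq> A \<times> A"
  shows "invariant E"
  unfolding invariant_def
proof (intro conjI ballI impI)
  fix x y x' y'
  assume A: "x \<in> A" "y \<in> A" "x' \<in> A" "y' \<in> A" and c: "c x y = c x' y'" and xy: "(x, y) \<in> E"
  obtain \<phi> xs where E_eq: "as_relation E = {map v xs | v. range v \<subseteq> A \<and> sat A v \<phi>}"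
    and \<phi>: "symbols \<phi> \<subseteq> as_relation ` M" and "distinct xs"
    using E(1) unfolding FO3_def by blast
  from xy have "[x, y] \<in> {map v xs | v. range v \<subseteq> A \<and> sat A v \<phi>}"
    by (simp flip: E_eq)
  then obtain v where v: "[x, y] = map v xs" "range v \<subseteq> A" "sat A v \<phi>"
    by (elim CollectE exE conjE)
  then obtain i j where xs: "xs = [i, j]" and ij: "v i = x" "v j = y"
    by (auto simp: Cons_eq_map_conv)
  have "i \<noteq> j"
    using \<open>distinct xs\<close> xs by simp
  obtain k where k: "k \<noteq> i" "k \<noteq> j" "\<And>l. l = i \<or> l = j \<or> l = k"
  proof -
    obtain a b where "\<And>l. l = i \<or> l = a \<or> l = b" "i \<noteq> a" "i \<noteq> b" "a \<noteq> b"
      using other_vars[of i] by metis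
    then show ?thesis
      using that[of a] that[of b] \<open>i \<noteq> j\<close> by metis
  qed
  have vk: "v k \<in> A"
    using v(2) by auto
  \<comment> \<open>\<open>sat_cong\<close> compares full assignments, so the third variable needs a
    value too: \<open>z'\<close> forms with \<open>x'\<close> and \<open>y'\<close> a triangle
    coloured like the one of \<open>v k\<close>, \<open>x\<close> and \<open>y\<close>.\<close>
  obtain z' where z': "z' \<in> A" "c x' z' = c x (v k)" "c z' y' = c (v k) y"
    using extend[OF A(1,2) vk A(3,4) c] by blast
  define w where "w l = (if l = i then x' else if l = j then y' else z')" for l
  have w: "w i = x'" "w j = y'" "w k = z'"
    using k \<open>i \<noteq> j\<close> by (auto simp: w_def)
  have refl: "c a a = c b b" if "a \<in> A" "b \<in> A" for a b
    using eq_iff that by metis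
  have sym': "c y x = c y' x'" "c z' x' = c (v k) x" "c y' z' = c y (v k)"
    using A c z' vk by (metis sym)+
  have "c (v l) (v m) = c (w l) (w m)" for l m
    using k(3)[of l] k(3)[of m] ij w c z' sym' refl A vk by auto
  moreover have "range w \<subseteq> A"
    using A z' by (auto simp: w_def)
  ultimately have "sat A w \<phi>"
    using sat_cong[OF M \<phi> v(2)] v(3) by blast
  then have "map w xs \<in> as_relation E"
    unfolding E_eq using \<open>range w \<subseteq> A\<close> by blast
  then show "(x', y') \<in> E"
    by (simp add: xs w)
qed (rule E(2))

text \<open>Both closures contain \<open>M\<close> and yield only invariant binary relations, so a
  set that already consists of all invariant equivalence relations gains none.\<close>

theorem Eq_RA_FO3:
  assumes "\<And>E. E \<in> M \<longleftrightarrow> equiv A E \<and> invariant E"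
  shows "Eq A (as_relation ` RA A M) = M" "Eq A (FO3 A (as_relation ` M)) = M"
proof -
  show "Eq A (as_relation ` RA A M) = M"
    unfolding Eq_as_relation_image using assms invariant_RA RA.base by blast
  show "Eq A (FO3 A (as_relation ` M)) = M"
  proof
    show "Eq A (FO3 A (as_relation ` M)) \<subseteq> M"
      using assms invariant_FO3[of M] equiv_type by (fastforce simp: Eq_def)
    show "M \<subseteq> Eq A (FO3 A (as_relation ` M))"
      using assms by (auto simp: Eq_def intro!: as_relation_in_FO3 dest: invariant_subset)
  qed
qed

end


section \<open>Colouring the directions of a net\<close>

text \<open>An affine plane of order \<open>p\<close>, where \<open>f i x\<close> labels the line
  through \<open>x\<close> in direction \<open>i\<close>, for the \<open>p + 1\<close> directions 0
  to \<open>p\<close>. Directions 1 to \<open>n\<close> are the chosen ones; 0 and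
  \<open>n + 1\<close> to \<open>p\<close> are left over, at least three of them by
  \<open>n_p\<close>.\<close>

locale net =
  fixes A :: "'a set" and f :: "nat \<Rightarrow> 'a \<Rightarrow> nat" and p n :: nat
  assumes n_pos: "1 \<le> n" and n_p: "n + 2 \<le> p"
    and direction: "\<And>x y. x \<in> A \<Longrightarrow> y \<in> A \<Longrightarrow> x \<noteq> y \<Longrightarrow> \<exists>!i. i \<le> p \<and> f i x = f i y"
    and lines_meet: "\<And>i j x y. i \<le> p \<Longrightarrow> j \<le> p \<Longrightarrow> i \<noteq> j \<Longrightarrow> x \<in> A \<Longrightarrow> y \<in> A \<Longrightarrow>
      \<exists>z\<in>A. f i z = f i x \<and> f j z = f j y"
    and two_points: "\<exists>x\<in>A. \<exists>y\<in>A. x \<noteq> y"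
begin

definition dir :: "'a \<Rightarrow> 'a \<Rightarrow> nat" where
  "dir x y = (THE i. i \<le> p \<and> f i x = f i y)"

text \<open>Direction 0 goes to the leftover class, which keeps the number 0 free as the colour of
  equal points.\<close>

definition dir_class :: "nat \<Rightarrow> nat" where
  "dir_class i = (if 1 \<le> i \<and> i \<le> n then i else n + 1)"

definition colour :: "'a \<Rightarrow> 'a \<Rightarrow> nat" where
  "colour x y = (if x = y then 0 else dir_class (dir x y))"

lemma dir:
  assumes "x \<in> A" "y \<in> A" "x \<noteq> y"
  shows "dir x y \<le> p" "f (dir x y) x = f (dir x y) y"
  using theI'[OF direction[OF assms]] by (auto simp: dir_def)

lemma dir_eqI:
  "x \<in> A \<Longrightarrow> y \<in> A \<Longrightarrow> x \<noteq> y \<Longrightarrow> i \<le> p \<Longrightarrow> f i x = f i y \<Longrightarrow> dir x y = i"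
  using direction dir by metis

lemma dir_sym: "dir x y = dir y x"
  unfolding dir_def by metis

lemma dir_class_ge_1: "1 \<le> dir_class i"
  by (simp add: dir_class_def)

lemma dir_class_le: "dir_class i \<le> n + 1"
  by (simp add: dir_class_def)

lemma dir_class_eq_iff: "1 \<le> k \<Longrightarrow> k \<le> n \<Longrightarrow> dir_class i = k \<longleftrightarrow> i = k"
  by (auto simp: dir_class_def)

text \<open>The three directions \<open>0\<close>, \<open>n + 1\<close> and \<open>n + 2\<close> have the same class, so two of them can always
  be avoided.\<close>

lemma pick_direction:
  assumes "i \<le> p" "1 \<le> i \<Longrightarrow> i \<le> n \<Longrightarrow> i \<noteq> a \<and> i \<noteq> b"
  obtains j where "j \<le> p" "dir_class j = dir_class i" "j \<noteq> a" "j \<noteq> b"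
proof (cases "1 \<le> i \<and> i \<le> n")
  case True
  then show ?thesis
    using assms that[of i] by auto
next
  case False
  have "\<exists>j\<in>{0, n + 1, n + 2}. j \<noteq> a \<and> j \<noteq> b" by auto
  then obtain j where "j \<in> {0, n + 1, n + 2}" "j \<noteq> a" "j \<noteq> b" by blast
  then show ?thesis
    using that[of j] False n_p by (auto simp: dir_class_def)
qed

lemma colour_le: "colour x y \<le> n + 1"
  using dir_class_le by (simp add: colour_def)

lemma colour_0_iff: "colour x y = 0 \<longleftrightarrow> x = y"
  using dir_class_ge_1[of "dir x y"] by (simp add: colour_def)

lemma colour_sym: "colour x y = colour y x"
  by (simp add: colour_def dir_sym)

text \<open>Unless some second point \<open>w\<close> already lies in direction \<open>i\<close>,
  the line through \<open>x\<close> in that direction is met with a line through \<open>w\<close> in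
  a third direction \<open>j\<close>. The latter misses \<open>x\<close> because \<open>j\<close>
  differs from \<open>dir x w\<close>.\<close>

lemma point_in_direction:
  assumes "x \<in> A" "i \<le> p"
  obtains y where "y \<in> A" "y \<noteq> x" "dir x y = i"
proof -
  obtain w where w: "w \<in> A" "w \<noteq> x"
    using two_points by metis
  show ?thesis
  proof (cases "dir x w = i")
    case True
    then show ?thesis using that w by auto
  next
    case False
    obtain j where j: "j \<in> {0, n + 1, n + 2}" "j \<noteq> i" "j \<noteq> dir x w"
    proof -
      have "\<exists>j\<in>{0, n + 1, n + 2}. j \<noteq> i \<and> j \<noteq> dir x w" by auto
      then show ?thesis using that by blast
    qed
    then have jp: "j \<le> p"
      using n_p by auto
    obtain y where y: "y \<in> A" "f i y = f i x" "f j y = f j w"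
      using lines_meet[of i j x w] assms w j jp by metis
    have "y \<noteq> x"
      using y j dir_eqI[OF assms(1) w(1) _ jp] w by auto
    then show ?thesis
      using that[of y] y dir_eqI[of x y i] assms by auto
  qed
qed

lemma ex_colour:
  assumes "x \<in> A" "k \<le> n + 1"
  obtains y where "y \<in> A" "colour x y = k"
proof (cases "k = 0")
  case True
  then show ?thesis
    using that assms by (auto simp: colour_def)
next
  case False
  then have "k \<le> p" "dir_class k = k"
    using assms n_p by (auto simp: dir_class_def)
  then show ?thesis
    using that point_in_direction[OF assms(1), of k] by (metis colour_def)
qed

lemma triangle:
  assumes "x \<in> A" "y \<in> A" "x \<noteq> y" "i \<le> p" "j \<le> p" "i \<noteq> j" "i \<noteq> dir x y" "j \<noteq> dir x y"
  obtains z where "z \<in> A" "z \<noteq> x" "z \<noteq> y" "dir x z = i" "dir z y = j"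
proof -
  obtain z where z: "z \<in> A" "f i z = f i x" "f j z = f j y"
    using lines_meet[OF assms(4-6,1,2)] by blast
  have "z \<noteq> x" "z \<noteq> y"
    using z dir_eqI[OF assms(1-3)] assms by metis+
  then show ?thesis
    using that[of z] z dir_eqI assms by metis
qed

text \<open>A triangle over \<open>x\<close> and \<open>y\<close> gives a point \<open>w\<close> off
  their line, which is then projected back onto it in a fourth direction \<open>l\<close>. The
  projection is neither \<open>x\<close> nor \<open>y\<close>, as these lie in directions
  \<open>j\<close> and \<open>k\<close> from \<open>w\<close>.\<close>

lemma third_point:
  assumes "x \<in> A" "y \<in> A" "x \<noteq> y"
  obtains z where "z \<in> A" "z \<noteq> x" "z \<noteq> y" "dir x z = dir x y" "dir z y = dir x y"
proof -
  define i where "i = dir x y"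
  obtain j k l where jkl: "j \<le> p" "k \<le> p" "l \<le> p" "distinct [i, j, k, l]"
  proof -
    have "3 \<le> p" "i = 0 \<or> i = 1 \<or> i = 2 \<or> i \<ge> 3"
      using n_pos n_p by linarith+
    then show ?thesis
      using that[of 1 2 3] that[of 0 2 3] that[of 0 1 3] that[of 0 1 2] by auto
  qed
  obtain w where w: "w \<in> A" "w \<noteq> x" "w \<noteq> y" "dir x w = j" "dir w y = k"
    using triangle[OF assms, of j k] jkl by (auto simp: i_def)
  obtain z where z: "z \<in> A" "f i z = f i x" "f l z = f l w"
    using lines_meet[of i l x w] jkl assms w dir(1)[OF assms] by (auto simp: i_def)
  have "z \<noteq> x"
    using z dir_eqI[of x w l] w jkl assms by auto
  moreover have "z \<noteq> y"
    using z dir_eqI[of w y l] w jkl assms by auto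
  moreover have "f i z = f i y"
    using z dir(2)[OF assms] by (simp add: i_def)
  ultimately show ?thesis
    using that[of z] z dir_eqI[of x z i] dir_eqI[of z y i] assms dir(1)[OF assms]
    by (auto simp: i_def)
qed

text \<open>Three distinct points determine either one common direction or three different ones. The
  first kind is copied by \<open>third_point\<close>. For the second kind, new directions are picked
  inside the required classes: a chosen direction is forced, while the leftover class offers three
  candidates of which at most two must be avoided.\<close>

lemma colour_extend:
  assumes A: "x \<in> A" "y \<in> A" "z \<in> A" "x' \<in> A" "y' \<in> A"
    and eq: "colour x y = colour x' y'"
  shows "\<exists>z'\<in>A. colour x' z' = colour x z \<and> colour z' y' = colour z y"
proof -
  have eq_iff: "x = y \<longleftrightarrow> x' = y'"
    using eq colour_0_iff by metis
  consider "x = y" | "x \<noteq> y" "z = x" | "x \<noteq> y" "z = y" | "x \<noteq> y" "z \<noteq> x" "z \<noteq> y"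
    by blast
  then show ?thesis
  proof cases
    case 1
    then show ?thesis
      using ex_colour[OF A(4) colour_le[of x z]] eq_iff colour_sym by metis
  next
    case 2
    then show ?thesis
      using A eq colour_0_iff by metis
  next
    case 3
    then show ?thesis
      using A eq colour_0_iff by metis
  next
    case 4
    define d d' e g where "d = dir x y" and "d' = dir x' y'" and "e = dir x z" and "g = dir z y"
    have xy': "x' \<noteq> y'"
      using 4 eq_iff by blast
    have cls: "dir_class d = dir_class d'"
      using eq 4(1) xy' by (simp add: colour_def d_def d'_def)
    have le: "d \<le> p" "e \<le> p" "g \<le> p"
      using A 4 by (auto simp: d_def e_def g_def dir)
    have eqs: "f d x = f d y" "f e x = f e z" "f g z = f g y"
      using A 4 by (auto simp: d_def e_def g_def intro: dir(2))
    show ?thesis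
    proof (cases "e = d")
      case True
      then have "g = d"
        using eqs A 4 le dir_eqI[of z y d] by (simp add: g_def)
      obtain z' where "z' \<in> A" "z' \<noteq> x'" "z' \<noteq> y'" "dir x' z' = d'" "dir z' y' = d'"
        using third_point[OF A(4,5) xy'] d'_def by metis
      moreover have "dir x z = d" "dir z y = d"
        using True \<open>g = d\<close> by (simp_all add: e_def g_def)
      ultimately show ?thesis
        using 4 cls by (auto simp: colour_def)
    next
      case False
      have "g \<noteq> d"
        using False eqs A 4 le dir_eqI[of x z d] by (auto simp: e_def)
      have "g \<noteq> e"
        using False eqs A 4 le dir_eqI[of x y e] by (auto simp: d_def)
      obtain e' where e': "e' \<le> p" "dir_class e' = dir_class e" "e' \<noteq> d'"
      proof (rule pick_direction[of e d' d'])
        \<comment> \<open>If \<open>e\<close> were \<open>d'\<close>, then \<open>d\<close>, having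
          the class of \<open>d'\<close>, would be the same chosen direction, against
          \<open>e \<noteq> d\<close>.\<close>
        show "e \<noteq> d' \<and> e \<noteq> d'" if "1 \<le> e" "e \<le> n"
          using that cls False
          by (auto simp: dir_class_def split: if_splits)
      qed (use le in auto)
      obtain g' where g': "g' \<le> p" "dir_class g' = dir_class g" "g' \<noteq> d'" "g' \<noteq> e'"
      proof (rule pick_direction[of g d' e'])
        show "g \<noteq> d' \<and> g \<noteq> e'" if "1 \<le> g" "g \<le> n"
          using that cls e' \<open>g \<noteq> d\<close> \<open>g \<noteq> e\<close>
          by (auto simp: dir_class_def split: if_splits)
      qed (use le in auto)
      obtain z' where "z' \<in> A" "z' \<noteq> x'" "z' \<noteq> y'" "dir x' z' = e'" "dir z' y' = g'"
        using triangle[OF A(4,5) xy' e'(1) g'(1)] e' g' by (metis d'_def)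
      then show ?thesis
        using 4 e' g' by (auto simp: colour_def e_def g_def)
    qed
  qed
qed

sublocale extendable_colouring A colour
  by unfold_locales (simp add: colour_0_iff, rule colour_sym, rule colour_extend)

section \<open>Equivalence relations that are unions of colours\<close>

definition rel :: "nat \<Rightarrow> 'a rel" where
  "rel k = {(x, y) \<in> A \<times> A. colour x y = 0 \<or> colour x y = k \<or> k = n + 1}"

lemma rel_0: "rel 0 = Id_on A"
  by (auto simp: rel_def colour_0_iff)

lemma rel_top: "rel (n + 1) = A \<times> A"
  by (auto simp: rel_def)

lemma rel_line:
  assumes "1 \<le> k" "k \<le> n"
  shows "rel k = {(x, y) \<in> A \<times> A. f k x = f k y}"
proof -
  have "colour x y = 0 \<or> colour x y = k \<longleftrightarrow> f k x = f k y" if "x \<in> A" "y \<in> A" for x y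
  proof (cases "x = y")
    case False
    then show ?thesis
      using assms n_p that dir_eqI[of x y k] dir[of x y] colour_0_iff[of x y]
      by (auto simp: colour_def dir_class_eq_iff)
  qed (simp add: colour_0_iff)
  then show ?thesis
    using assms by (auto simp: rel_def)
qed

text \<open>A pair of points belongs to \<open>rel k\<close> exactly if its colour lies below
  \<open>k\<close> in \<open>M_lattice n\<close>. Since every colour up to \<open>n + 1\<close>
  occurs, inclusion reproduces that order.\<close>

lemma rel_subset_iff:
  assumes "k \<le> n + 1"
  shows "rel k \<subseteq> rel l \<longleftrightarrow> k = l \<or> k = 0 \<or> l = n + 1"
proof
  assume sub: "rel k \<subseteq> rel l"
  obtain x where "x \<in> A"
    using two_points by blast
  then obtain y where "y \<in> A" "colour x y = k"
    using ex_colour assms by blast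
  then have "(x, y) \<in> rel l"
    using sub \<open>x \<in> A\<close> by (auto simp: rel_def)
  then show "k = l \<or> k = 0 \<or> l = n + 1"
    using \<open>colour x y = k\<close> by (auto simp: rel_def)
qed (auto simp: rel_def)

lemma equiv_rel:
  assumes "k \<le> n + 1"
  shows "equiv A (rel k)"
proof -
  consider "k = 0" | "1 \<le> k" "k \<le> n" | "k = n + 1"
    using assms by linarith
  then show ?thesis
  proof cases
    case 1
    then show ?thesis
      by (auto simp: rel_0 equiv_def refl_on_def sym_on_def trans_on_def)
  next
    case 2
    then show ?thesis
      by (auto simp: rel_line equiv_def refl_on_def sym_on_def trans_on_def)
  next
    case 3
    then show ?thesis
      using rel_top by (auto simp: equiv_def refl_on_def sym_on_def trans_on_def)
  qed
qed

lemma invariant_rel: "invariant (rel k)"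
  by (auto simp: invariant_def rel_def)

text \<open>Any two points are joined by a step in direction \<open>i\<close> followed by one in
  direction \<open>j\<close>.\<close>

lemma equiv_two_directions:
  assumes "equiv A E" "i \<le> p" "j \<le> p" "i \<noteq> j"
    and "\<And>x y. x \<in> A \<Longrightarrow> y \<in> A \<Longrightarrow> f i x = f i y \<Longrightarrow> (x, y) \<in> E"
    and "\<And>x y. x \<in> A \<Longrightarrow> y \<in> A \<Longrightarrow> f j x = f j y \<Longrightarrow> (x, y) \<in> E"
  shows "E = A \<times> A"
proof
  show "A \<times> A \<subseteq> E"
  proof clarify
    fix x y assume "x \<in> A" "y \<in> A"
    then obtain z where "z \<in> A" "f i z = f i x" "f j z = f j y"
      using lines_meet assms(2-4) by blast
    then have "(x, z) \<in> E" "(z, y) \<in> E"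
      using assms(5,6) \<open>x \<in> A\<close> \<open>y \<in> A\<close> by metis+
    then show "(x, y) \<in> E"
      using \<open>equiv A E\<close> by (meson equiv_def transE)
  qed
qed (use assms(1) equiv_type in blast)

text \<open>Invariance spreads a single pair to all pairs of its colour. For the leftover colour
  this yields the lines of several directions at once.\<close>

lemma invariant_contains_lines:
  assumes E: "equiv A E" "invariant E" "(x, y) \<in> E" "x \<noteq> y"
    and i: "i \<le> p" "dir_class i = dir_class (dir x y)"
    and uv: "u \<in> A" "v \<in> A" "f i u = f i v"
  shows "(u, v) \<in> E"
proof (cases "u = v")
  case True
  then show ?thesis
    using E(1) uv by (metis equiv_class_eq_iff)
next
  case False
  then have "dir u v = i"
    using dir_eqI uv i by blast
  then have "colour x y = colour u v"
    using False E(4) i by (simp add: colour_def)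
  then show ?thesis
    using invariantD E uv by blast
qed

text \<open>A nontrivial invariant equivalence relation contains all lines in the direction
  \<open>d\<close> of one of its pairs. If \<open>d\<close> is chosen and no other direction occurs,
  it is \<open>rel d\<close>; otherwise it contains the lines of two directions and is full.\<close>

lemma equiv_invariant_iff: "E \<in> rel ` {0..n + 1} \<longleftrightarrow> equiv A E \<and> invariant E"
proof
  assume "E \<in> rel ` {0..n + 1}"
  then show "equiv A E \<and> invariant E"
    using equiv_rel invariant_rel by auto
next
  assume E: "equiv A E \<and> invariant E"
  have EA: "E \<subseteq> A \<times> A"
    using E equiv_type by blast
  show "E \<in> rel ` {0..n + 1}"
  proof (cases "E \<subseteq> Id")
    case True
    then have "E = rel 0"
      using E EA by (auto simp: rel_0 equiv_def refl_on_def)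
    then show ?thesis by auto
  next
    case False
    then obtain x y where xy: "(x, y) \<in> E" "x \<noteq> y" by auto
    define d where "d = dir x y"
    have d: "d \<le> p"
      using xy EA dir by (auto simp: d_def)
    have d_lines: "(u, v) \<in> E" if "i \<le> p" "dir_class i = dir_class d" "u \<in> A" "v \<in> A" "f i u = f i v"
      for u v i
      using invariant_contains_lines[of E x y i u v] E xy that by (auto simp: d_def)
    show ?thesis
    proof (cases "(\<forall>(u, v)\<in>E. u = v \<or> dir u v = d) \<and> 1 \<le> d \<and> d \<le> n")
      case True
      have "E = rel d"
      proof
        show "E \<subseteq> rel d"
          using True EA by (auto simp: rel_def colour_def dir_class_def)
        show "rel d \<subseteq> E"
          using True d d_lines by (auto simp: rel_line)
      qed
      then show ?thesis
        using True by auto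
    next
      case False
      then consider "dir_class d = n + 1" | u v where "(u, v) \<in> E" "u \<noteq> v" "dir u v \<noteq> d"
        by (auto simp: dir_class_def)
      then have "E = A \<times> A"
      proof cases
        case 1
        \<comment> \<open>Directions 0 and \<open>n + 1\<close> are two different members of the
          leftover class.\<close>
        then show ?thesis
          using E n_p d_lines[of 0] d_lines[of "n + 1"]
          by (intro equiv_two_directions[of E 0 "n + 1"]) (simp_all add: dir_class_def)
      next
        case 2
        then have "u \<in> A" "v \<in> A"
          using EA by auto
        then show ?thesis
          using E 2 d d_lines dir(1)[of u v] invariant_contains_lines[of E u v "dir u v"]
          by (intro equiv_two_directions[of E d "dir u v"]) auto
      qed
      then show ?thesis
        using rel_top by (metis atLeastAtMost_iff imageI le_refl zero_le)
    qed
  qed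
qed

section \<open>Lattice structure of these relations\<close>

lemma rel_Int_incomparable:
  assumes "1 \<le> k" "k \<le> n" "1 \<le> l" "l \<le> n" "k \<noteq> l"
  shows "rel k \<inter> rel l = rel 0"
  using assms by (auto simp: rel_def)

lemma rel_join_incomparable:
  assumes "1 \<le> k" "k \<le> n" "1 \<le> l" "l \<le> n" "k \<noteq> l"
  shows "equiv_join A (rel k) (rel l) = rel (n + 1)"
proof
  show "equiv_join A (rel k) (rel l) \<subseteq> rel (n + 1)"
    using assms equiv_rel by (intro equiv_join_subset) (auto simp: rel_subset_iff)
  have "G = A \<times> A" if "equiv A G" "rel k \<union> rel l \<subseteq> G" for G
    using that assms n_p by (intro equiv_two_directions[of G k l]) (auto simp: rel_line)
  then show "rel (n + 1) \<subseteq> equiv_join A (rel k) (rel l)"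
    using rel_top by (auto simp: equiv_join_def)
qed

lemma equiv_lattice_rel: "equiv_lattice A (rel ` {0..n + 1})"
proof -
  have "rel k \<inter> rel l \<in> rel ` {0..n + 1} \<and> equiv_join A (rel k) (rel l) \<in> rel ` {0..n + 1}"
    if kl: "k \<le> n + 1" "l \<le> n + 1" for k l
  proof -
    have comparable: ?thesis if "rel k \<subseteq> rel l \<or> rel l \<subseteq> rel k"
    proof -
      have "rel k \<inter> rel l \<in> {rel k, rel l}"
        using that by auto
      moreover have "equiv_join A (rel k) (rel l) \<in> {rel k, rel l}"
        using that equiv_join_upper[of "rel k" A "rel l"] equiv_join_upper[of "rel l" A "rel k"]
          equiv_join_subset[of A "rel k" "rel k" "rel l"] equiv_join_subset[of A "rel l" "rel k" "rel l"]
          equiv_rel[OF kl(1)] equiv_rel[OF kl(2)] by auto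
      ultimately show ?thesis
        using kl by auto
    qed
    show ?thesis
    proof (cases "rel k \<subseteq> rel l \<or> rel l \<subseteq> rel k")
      case False
      then have "1 \<le> k" "k \<le> n" "1 \<le> l" "l \<le> n" "k \<noteq> l"
        using kl by (auto simp: rel_subset_iff)
      then show ?thesis
        using rel_Int_incomparable rel_join_incomparable by auto
    qed (rule comparable)
  qed
  then show ?thesis
    using equiv_rel by (auto simp: equiv_lattice_def)
qed

lemma lattice_isomorphic_rel:
  "lattice_isomorphic (inclusion_order (rel ` {0..n + 1})) (M_lattice n)"
proof -
  have inj: "inj_on rel {0..n + 1}"
    proof (rule inj_onI)
    fix k l assume "k \<in> {0..n + 1}" "l \<in> {0..n + 1}" "rel k = rel l"
    then show "k = l"
      using rel_subset_iff[of k l] rel_subset_iff[of l k] by auto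
  qed
  show ?thesis
  proof (rule order_iso_imp_lattice_isomorphic)
    show "lattice (inclusion_order (rel ` {0..n + 1}))"
      by (rule lattice_inclusion_order[OF equiv_lattice_rel])
    \<comment> \<open>The map runs from relations to indices because the transfer lemma starts from
      an order known to be a lattice, here the inclusion order.\<close>
    show "bij_betw (inv_into {0..n + 1} rel) (carrier (inclusion_order (rel ` {0..n + 1})))
        (carrier (M_lattice n))"
      using inj by (simp add: inclusion_order_def M_lattice_def bij_betw_inv_into inj_on_imp_bij_betw)
    show "inv_into {0..n + 1} rel E \<sqsubseteq>\<^bsub>M_lattice n\<^esub> inv_into {0..n + 1} rel F \<longleftrightarrow>
        E \<sqsubseteq>\<^bsub>inclusion_order (rel ` {0..n + 1})\<^esub> F"
      if "E \<in> carrier (inclusion_order (rel ` {0..n + 1}))"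
        "F \<in> carrier (inclusion_order (rel ` {0..n + 1}))" for E F
    proof -
      have "E \<in> rel ` {0..n + 1}" "F \<in> rel ` {0..n + 1}"
        using that by (simp_all add: inclusion_order_def)
      then obtain k l where "E = rel k" "F = rel l" "k \<in> {0..n + 1}" "l \<in> {0..n + 1}"
        by blast
      then show ?thesis
        using inj rel_subset_iff by (simp add: inclusion_order_def M_lattice_def)
    qed
  qed (simp add: M_lattice_def)
qed

end


section \<open>The affine plane over a prime field\<close>

text \<open>The point with coordinates \<open>u\<close> and \<open>v\<close> is encoded as \<open>u * p + v\<close>. For \<open>i < p\<close> the lines in
  direction \<open>i\<close> have slope \<open>- i\<close>, and direction \<open>p\<close> is vertical.\<close>

definition plane_line :: "nat \<Rightarrow> nat \<Rightarrow> nat \<Rightarrow> nat" where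
  "plane_line p i a = (if i < p then (a mod p + i * (a div p)) mod p else a div p)"

lemma plane_line_eq_iff:
  "i < p \<Longrightarrow> plane_line p i a = plane_line p i b \<longleftrightarrow>
    [int (a mod p) + int i * int (a div p) = int (b mod p) + int i * int (b div p)] (mod int p)"
  by (simp add: plane_line_def flip: cong_def of_nat_mult of_nat_add cong_int_iff)

lemma plane_pointE:
  fixes u v :: int and p :: nat
  assumes "p > 0"
  obtains z where "z < p * p" "[int (z div p) = u] (mod int p)" "[int (z mod p) = v] (mod int p)"
proof
  define a b where "a = nat (u mod int p)" and "b = nat (v mod int p)"
  have ab: "a < p" "b < p"
    using assms by (simp_all add: a_def b_def nat_less_iff)
  let ?z = "a * p + b"
  have "?z < p * p"
  proof -
    have "?z < (a + 1) * p" using ab by simp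
    also have "\<dots> \<le> p * p" using ab by (intro mult_right_mono) auto
    finally show ?thesis .
  qed
  then show "?z < p * p" .
  show "[int (?z div p) = u] (mod int p)" "[int (?z mod p) = v] (mod int p)"
    using ab assms by (simp_all add: a_def b_def cong_def)
qed

lemma nat_eq_if_int_cong:
  "a < p \<Longrightarrow> b < p \<Longrightarrow> [int a = int b] (mod int p) \<Longrightarrow> a = (b :: nat)"
  by (simp add: cong_int_iff cong_less_modulus_unique_nat)

lemma diff_invertible_mod_prime:
  fixes a b p :: nat
  assumes "prime p" "a < p" "b < p" "a \<noteq> b"
  obtains c where "[(int a - int b) * c = 1] (mod int p)"
proof -
  have "\<not> int p dvd int a - int b"
    using nat_eq_if_int_cong[OF assms(2,3)] assms(4) by (auto simp: cong_iff_dvd_diff)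
  then have "coprime (int a - int b) (int p)"
    using assms(1) by (metis coprime_commute prime_imp_coprime prime_nat_int_transfer)
  then show ?thesis
    using that cong_solve_coprime_int by blast
qed

text \<open>Subtracting the two line equations shows that \<open>p\<close> divides
  \<open>i - j\<close> times the difference of the first coordinates, so by primality these agree,
  and then the second ones do. With \<open>j < i\<close>, only direction \<open>i\<close> can be
  vertical.\<close>

lemma plane_point_eqI:
  assumes p: "prime p" and ab: "a < p * p" "b < p * p" and ij: "i \<le> p" "j < i"
    and eq: "plane_line p i a = plane_line p i b" "plane_line p j a = plane_line p j b"
  shows "a = b"
proof -
  have div_less: "a div p < p" "b div p < p"
    using ab by (simp_all add: less_mult_imp_div_less)
  have p0: "p > 0"
    using p prime_gt_0_nat by blast
  let ?u = "int (a div p) - int (b div p)" and ?v = "int (a mod p) - int (b mod p)"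
  have j: "int p dvd ?v + int j * ?u"
    using eq(2) ij plane_line_eq_iff[of j p a b] by (simp add: cong_iff_dvd_diff algebra_simps)
  have u: "a div p = b div p"
  proof (cases "i < p")
    case True
    have "int p dvd ?v + int i * ?u"
      using eq(1) True plane_line_eq_iff[of i p a b] by (simp add: cong_iff_dvd_diff algebra_simps)
    then have "int p dvd (?v + int i * ?u) - (?v + int j * ?u)"
      using j by (rule dvd_diff)
    then have "int p dvd (int i - int j) * ?u"
      by (simp add: algebra_simps)
    moreover have "\<not> int p dvd int i - int j"
      using nat_eq_if_int_cong[of i p j] ij True by (auto simp: cong_iff_dvd_diff)
    ultimately have "int p dvd ?u"
      using p by (metis prime_dvd_mult_iff prime_nat_int_transfer)
    then show ?thesis
      using nat_eq_if_int_cong[OF div_less] by (simp add: cong_iff_dvd_diff)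
  qed (use eq(1) in \<open>simp add: plane_line_def\<close>)
  then have "int p dvd ?v"
    using j by simp
  then have "a mod p = b mod p"
    using nat_eq_if_int_cong[of "a mod p" p "b mod p"] p0 by (simp add: cong_iff_dvd_diff)
  with u show ?thesis
    by (metis div_mod_decomp)
qed

text \<open>The equations \<open>v + i * u = s\<close> and \<open>v + j * u = t\<close> are solved
  modulo \<open>p\<close> by dividing \<open>s - t\<close> by \<open>i - j\<close>. If direction
  \<open>i\<close> is vertical, \<open>u\<close> is given and the second equation yields
  \<open>v\<close>.\<close>

lemma plane_lines_meet:
  assumes p: "prime p" and ab: "a < p * p" and ij: "i \<le> p" "j < i"
  obtains z where "z < p * p" "plane_line p i z = plane_line p i a" "plane_line p j z = plane_line p j b"
proof -
  have p0: "p > 0"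
    using p prime_gt_0_nat by blast
  define t where "t = int (b mod p) + int j * int (b div p)"
  show ?thesis
  proof (cases "i < p")
    case True
    define s where "s = int (a mod p) + int i * int (a div p)"
    obtain c where c: "[(int i - int j) * c = 1] (mod int p)"
      using diff_invertible_mod_prime[of p i j] p True ij by auto
    define u where "u = c * (s - t)"
    obtain z where z: "z < p * p" "[int (z div p) = u] (mod int p)"
      "[int (z mod p) = s - int i * u] (mod int p)"
      using plane_pointE[OF p0] by blast
    have "[int (z mod p) + int i * int (z div p) = (s - int i * u) + int i * u] (mod int p)"
      by (intro cong_add cong_mult z cong_refl)
    moreover have "[int (z mod p) + int j * int (z div p) = (s - int i * u) + int j * u] (mod int p)"
      by (intro cong_add cong_mult z cong_refl)
    moreover have "[(s - int i * u) + int j * u = t] (mod int p)"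
    proof -
      have "(s - int i * u) + int j * u = s - ((int i - int j) * c) * (s - t)"
        by (simp add: u_def algebra_simps)
      also have "[\<dots> = s - 1 * (s - t)] (mod int p)"
        by (intro cong_diff cong_mult c cong_refl)
      finally show ?thesis by simp
    qed
    ultimately show ?thesis
      using that[of z] z(1) True ij by (simp add: plane_line_eq_iff s_def t_def) (metis cong_trans)
  next
    case False
    define u where "u = int (a div p)"
    obtain z where z: "z < p * p" "[int (z div p) = u] (mod int p)"
      "[int (z mod p) = t - int j * u] (mod int p)"
      using plane_pointE[OF p0] by blast
    have "[int (z mod p) + int j * int (z div p) = (t - int j * u) + int j * u] (mod int p)"
      by (intro cong_add cong_mult z cong_refl)
    \<comment> \<open>Vertical lines are labelled by \<open>div\<close> without reduction modulo
      \<open>p\<close>, so congruence of the first coordinates is sharpened to equality.\<close>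
    moreover have "z div p = a div p"
      using z ab by (intro nat_eq_if_int_cong) (simp_all add: u_def less_mult_imp_div_less)
    ultimately show ?thesis
      using that[of z] z(1) False ij by (simp add: plane_line_eq_iff t_def) (simp add: plane_line_def)
  qed
qed

lemma plane_direction:
  assumes p: "prime p" and ab: "a < p * p" "b < p * p"
  obtains i where "i \<le> p" "plane_line p i a = plane_line p i b"
proof (cases "a div p = b div p")
  case True
  then show ?thesis
    using that[of p] by (simp add: plane_line_def)
next
  case False
  have p0: "p > 0"
    using p prime_gt_0_nat by blast
  have "a div p < p" "b div p < p"
    using ab by (simp_all add: less_mult_imp_div_less)
  then obtain c where c: "[(int (a div p) - int (b div p)) * c = 1] (mod int p)"
    using diff_invertible_mod_prime[OF p _ _ False] by blast
  define w where "w = int (b mod p) - int (a mod p)"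
  \<comment> \<open>As \<open>c\<close> inverts the difference of the first coordinates,
    \<open>i\<close> is minus the slope of the line through \<open>a\<close> and
    \<open>b\<close>.\<close>
  define i where "i = nat ((c * w) mod int p)"
  have "i < p" and i: "[int i = c * w] (mod int p)"
    using p0 by (simp_all add: i_def nat_less_iff cong_def)
  have "[(int (a div p) - int (b div p)) * int i = (int (a div p) - int (b div p)) * (c * w)] (mod int p)"
    by (intro cong_mult i cong_refl)
  also have "(int (a div p) - int (b div p)) * (c * w) = ((int (a div p) - int (b div p)) * c) * w"
    by simp
  also have "[\<dots> = 1 * w] (mod int p)"
    by (intro cong_mult c cong_refl)
  finally have "plane_line p i a = plane_line p i b"
    unfolding plane_line_eq_iff[OF \<open>i < p\<close>] by (simp add: w_def cong_iff_dvd_diff algebra_simps)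
  then show ?thesis
    using that[of i] \<open>i < p\<close> by simp
qed

lemma net_plane:
  assumes p: "prime p" and "1 \<le> n" "n + 2 \<le> p"
  shows "net {..<p * p} (plane_line p) p n"
proof
  fix a b assume ab: "a \<in> {..<p * p}" "b \<in> {..<p * p}"
  show "\<exists>!i. i \<le> p \<and> plane_line p i a = plane_line p i b" if "a \<noteq> b"
    using plane_direction[OF p] plane_point_eqI[OF p] ab that by (metis lessThan_iff nat_neq_iff)
  show "\<exists>z\<in>{..<p * p}. plane_line p i z = plane_line p i a \<and> plane_line p j z = plane_line p j b"
    if "i \<le> p" "j \<le> p" "i \<noteq> j" for i j
    \<comment> \<open>For \<open>i < j\<close> the lemma applies with \<open>a\<close> and
      \<open>b\<close> exchanged.\<close>
    using plane_lines_meet[OF p] ab that by (metis lessThan_iff nat_neq_iff)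
next
  have "1 < p"
    using p prime_gt_1_nat by blast
  then have "0 < p * p" "1 < p * p"
    using less_1_mult[of p p] by simp_all
  then show "\<exists>x\<in>{..<p * p}. \<exists>y\<in>{..<p * p}. x \<noteq> y"
    by (metis lessThan_iff zero_neq_one)
qed (use assms in auto)

theorem theorem2p2:
  fixes n :: nat
  assumes "n > 0"
  shows "\<exists>(A :: nat set) (M :: nat rel set).
    finite A \<and> equiv_lattice A M \<and>
    lattice_isomorphic (inclusion_order M) (M_lattice n) \<and>
    Eq A (as_relation ` RA A M) = Eq A (FO3 A (as_relation ` M)) \<and>
    Eq A (FO3 A (as_relation ` M)) = M"
proof -
  obtain p where p: "prime p" "p > n + 2"
    using bigger_prime by blast
  interpret net "{..<p * p}" "plane_line p" p n
    using p assms by (intro net_plane) auto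
  show ?thesis
    using equiv_lattice_rel lattice_isomorphic_rel Eq_RA_FO3[OF equiv_invariant_iff]
    by (intro exI[of _ "{..<p * p}"] exI[of _ "rel ` {0..n + 1}"]) simp
qed

end
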